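(* Let $A\in\mathbb{H}^{m\times n}$ have rank $r$, and let $M$ and $N$ be positive definite quaternion matrices of order $m$ and $n$, respectively. Then $$A^{\dagger}_{M,N}=\lim_{\lambda\to 0}(\lambda I+A^{\sharp}A)^{-1}A^{\sharp},$$ where $A^{\sharp}=N^{-1}A^{*}M$ and $\lambda$ ranges over the positive real numbers.
   Context: $\mathbb{H}$ is the skew field of real quaternions; $\mathbb{H}^{m\times n}$ is the set of $m\times n$ quaternion matrices; $A^{*}$ is the conjugate transpose. A matrix $P\in\mathbb{H}^{n\times n}$ is positive definite if it is Hermitian ($P^*=P$) and $x^{*}Px>0$ for every nonzero $x\in\mathbb{H}^{n}$. The weighted Moore-Penrose inverse $A^{\dagger}_{M,N}$ of $A$ is the unique $X\in\mathbb{H}^{n\times m}$ with $AXA=A$, $XAX=X$, $(MAX)^{*}=MAX$, $(NXA)^{*}=NXA$. *)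

theory Defs
  imports "HOL-Analysis.Analysis"
begin

section \<open>The skew field of real quaternions\<close>

datatype quat = Quat (qRe: real) (qI: real) (qJ: real) (qK: real)

lemma quat_eq_iff:
  "x = y \<longleftrightarrow> qRe x = qRe y \<and> qI x = qI y \<and> qJ x = qJ y \<and> qK x = qK y"
  by (cases x; cases y) simp

instantiation quat :: ring_1
begin

definition "0 = Quat 0 0 0 0"
definition "1 = Quat 1 0 0 0"
definition "x + y = Quat (qRe x + qRe y) (qI x + qI y) (qJ x + qJ y) (qK x + qK y)"
definition "- x = Quat (- qRe x) (- qI x) (- qJ x) (- qK x)"
definition "x - y = Quat (qRe x - qRe y) (qI x - qI y) (qJ x - qJ y) (qK x - qK y)"
definition "x * y = Quat
  (qRe x * qRe y - qI x * qI y - qJ x * qJ y - qK x * qK y)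
  (qRe x * qI y + qI x * qRe y + qJ x * qK y - qK x * qJ y)
  (qRe x * qJ y - qI x * qK y + qJ x * qRe y + qK x * qI y)
  (qRe x * qK y + qI x * qJ y - qJ x * qI y + qK x * qRe y)"

lemmas quat_ring_defs = zero_quat_def one_quat_def plus_quat_def uminus_quat_def
  minus_quat_def times_quat_def

instance
  by standard (simp_all add: quat_ring_defs algebra_simps)

end

definition qcnj :: "quat \<Rightarrow> quat" where
  "qcnj x = Quat (qRe x) (- qI x) (- qJ x) (- qK x)"

instantiation quat :: real_algebra_1
begin

definition "scaleR r x = Quat (r * qRe x) (r * qI x) (r * qJ x) (r * qK x)"

instance
  by standard (simp_all add: scaleR_quat_def quat_ring_defs algebra_simps)

end

instantiation quat :: real_normed_div_algebra
begin

definition "norm x = sqrt ((qRe x)\<^sup>2 + (qI x)\<^sup>2 + (qJ x)\<^sup>2 + (qK x)\<^sup>2)"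
definition "sgn x = x /\<^sub>R norm x" for x :: quat
definition "dist x y = norm (x - y)" for x y :: quat
definition [code del]:
  "(uniformity :: (quat \<times> quat) filter) = (INF e\<in>{0 <..}. principal {(x, y). dist x y < e})"
definition [code del]:
  "open (U :: quat set) \<longleftrightarrow> (\<forall>x\<in>U. eventually (\<lambda>(x', y). x' = x \<longrightarrow> y \<in> U) uniformity)"
definition "inverse x = qcnj x /\<^sub>R (norm x)\<^sup>2"
definition "x div y = x * inverse y" for x y :: quat

instance
proof
  fix x y :: quat and r :: real
  have norm_sq: "(norm z)\<^sup>2 = (qRe z)\<^sup>2 + (qI z)\<^sup>2 + (qJ z)\<^sup>2 + (qK z)\<^sup>2" for z :: quat
    by (simp add: norm_quat_def)
  have norm0: "norm z = 0 \<longleftrightarrow> z = 0" for z :: quat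
    by (simp add: norm_quat_def zero_quat_def quat_eq_iff add_nonneg_eq_0_iff)
  show "dist x y = norm (x - y)" by (rule dist_quat_def)
  show "sgn x = x /\<^sub>R norm x" by (rule sgn_quat_def)
  show "(uniformity :: (quat \<times> quat) filter) = (INF e\<in>{0 <..}. principal {(x, y). dist x y < e})"
    by (rule uniformity_quat_def)
  show "open U \<longleftrightarrow> (\<forall>x\<in>U. eventually (\<lambda>(x', y). x' = x \<longrightarrow> y \<in> U) uniformity)" for U :: "quat set"
    by (rule open_quat_def)
  show "norm x = 0 \<longleftrightarrow> x = 0" by (rule norm0)
  have pair: "norm z = norm (qRe z, qI z, qJ z, qK z)" for z :: quat
    by (simp add: norm_quat_def norm_Pair add.assoc)
  show "norm (x + y) \<le> norm x + norm y"
    using norm_triangle_ineq[of "(qRe x, qI x, qJ x, qK x)" "(qRe y, qI y, qJ y, qK y)"]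
    by (simp add: pair plus_quat_def)
  show "norm (r *\<^sub>R x) = \<bar>r\<bar> * norm x"
    by (simp add: norm_quat_def scaleR_quat_def power_mult_distrib real_sqrt_mult
        flip: distrib_left)
  have "(norm (x * y))\<^sup>2 = (norm x * norm y)\<^sup>2"
    unfolding norm_sq power_mult_distrib
    by (simp add: times_quat_def power2_eq_square algebra_simps)
  then show "norm (x * y) = norm x * norm y"
    by (rule power2_eq_imp_eq) (simp_all add: norm_quat_def)
  show "x div y = x * inverse y" by (rule divide_quat_def)
  show "inverse (0 :: quat) = 0"
    by (simp add: inverse_quat_def qcnj_def zero_quat_def scaleR_quat_def)
  show "inverse x * x = 1" "x * inverse x = 1" if "x \<noteq> 0"
  proof -
    have nz: "(norm x)\<^sup>2 \<noteq> 0"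
      using norm0[of x] that by simp
    have "qcnj x * x = (norm x)\<^sup>2 *\<^sub>R 1" "x * qcnj x = (norm x)\<^sup>2 *\<^sub>R 1"
      unfolding norm_sq
      by (simp_all add: qcnj_def scaleR_quat_def times_quat_def one_quat_def power2_eq_square)
    then show "inverse x * x = 1" "x * inverse x = 1"
      using nz by (simp_all add: inverse_quat_def)
  qed
qed

end

section \<open>Quaternion matrices\<close>

definition adjoint_mat :: "quat ^ 'n ^ 'm \<Rightarrow> quat ^ 'm ^ 'n" where
  "adjoint_mat A = (\<chi> i j. qcnj (A $ j $ i))"

text \<open>Linear combinations of columns take their coefficients on the right.\<close>
definition right_independent_columns :: "quat ^ 'n ^ 'm \<Rightarrow> 'n set \<Rightarrow> bool" where
  "right_independent_columns A J \<longleftrightarrow>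
     (\<forall>c :: 'n \<Rightarrow> quat. (\<Sum>j\<in>J. \<chi> i. A $ i $ j * c j) = 0 \<longrightarrow> (\<forall>j\<in>J. c j = 0))"

definition quat_rank :: "quat ^ 'n ^ 'm \<Rightarrow> nat" where
  "quat_rank A = Max (card ` {J. right_independent_columns A J})"

text \<open>The existential states that \<open>x\<^sup>* P x\<close> is a positive real number.\<close>
definition pos_def :: "quat ^ 'n ^ 'n \<Rightarrow> bool" where
  "pos_def P \<longleftrightarrow> adjoint_mat P = P \<and>
     (\<forall>x. x \<noteq> 0 \<longrightarrow> (\<exists>t::real. t > 0 \<and> (\<Sum>i\<in>UNIV. qcnj (x $ i) * (P *v x) $ i) = of_real t))"

definition is_weighted_MP_inverse ::
    "quat ^ 'm ^ 'm \<Rightarrow> quat ^ 'n ^ 'n \<Rightarrow> quat ^ 'n ^ 'm \<Rightarrow> quat ^ 'm ^ 'n \<Rightarrow> bool" where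
  "is_weighted_MP_inverse M N A X \<longleftrightarrow>
     A ** X ** A = A \<and> X ** A ** X = X \<and>
     adjoint_mat (M ** A ** X) = M ** A ** X \<and>
     adjoint_mat (N ** X ** A) = N ** X ** A"

definition weighted_MP_inverse ::
    "quat ^ 'm ^ 'm \<Rightarrow> quat ^ 'n ^ 'n \<Rightarrow> quat ^ 'n ^ 'm \<Rightarrow> quat ^ 'm ^ 'n" where
  "weighted_MP_inverse M N A = (THE X. is_weighted_MP_inverse M N A X)"

definition weighted_adjoint ::
    "quat ^ 'm ^ 'm \<Rightarrow> quat ^ 'n ^ 'n \<Rightarrow> quat ^ 'n ^ 'm \<Rightarrow> quat ^ 'm ^ 'n" where
  "weighted_adjoint M N A = matrix_inv N ** adjoint_mat A ** M"

end

theory Submission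
  imports Defs
begin

text \<open>
  Write \<open>G = A\<^sup>\<sharp>\<close>. The matrix \<open>adjoint_mat A\<close> is the adjoint of \<open>A\<close> for the real inner product
  \<open>Re (x\<^sup>* y)\<close>. Orthogonal projection onto the range of \<open>G A G\<close> gives \<open>W\<close> with \<open>G A G W = G\<close>, and
  \<open>X = G W\<close> then satisfies the four Penrose equations. If \<open>e = (X - (\<lambda>I + G A)\<^sup>-\<^sup>1 G) v\<close> and
  \<open>w = W v\<close>, then \<open>(\<lambda>N + A\<^sup>* M A) e = \<lambda> A\<^sup>* M w\<close>. Pairing with \<open>e\<close> and completing the square gives
  \<open>e\<^sup>* N e \<le> (\<lambda>/4) w\<^sup>* M w\<close>, so \<open>e\<close> tends to \<open>0\<close> because \<open>N\<close> is coercive.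
\<close>

section \<open>Quaternions as a Euclidean space\<close>

text \<open>Quaternion vectors thereby form a real Euclidean space, which supplies orthogonal
  decomposition and compactness of the unit sphere.\<close>

instantiation quat :: euclidean_space
begin

definition "inner x y = qRe x * qRe y + qI x * qI y + qJ x * qJ y + qK x * qK y"
definition "Basis = {Quat 1 0 0 0, Quat 0 1 0 0, Quat 0 0 1 0, Quat 0 0 0 1}"

instance
proof
  fix x y z :: quat and r :: real
  show "inner x y = inner y x" "inner (x + y) z = inner x z + inner y z"
    "inner (r *\<^sub>R x) y = r * inner x y"
    by (simp_all add: inner_quat_def plus_quat_def scaleR_quat_def algebra_simps)
  show "0 \<le> inner x x"
    by (simp add: inner_quat_def)
  show "inner x x = 0 \<longleftrightarrow> x = 0"
    by (simp add: inner_quat_def quat_eq_iff zero_quat_def add_nonneg_eq_0_iff)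
  show "norm x = sqrt (inner x x)"
    by (simp add: norm_quat_def inner_quat_def power2_eq_square)
  show "(Basis :: quat set) \<noteq> {}" "finite (Basis :: quat set)"
    by (simp_all add: Basis_quat_def)
  show "inner u v = (if u = v then 1 else 0)" if "u \<in> Basis" "v \<in> Basis" for u v :: quat
    using that unfolding Basis_quat_def inner_quat_def
    by (elim insertE emptyE) simp_all
  show "(\<forall>u\<in>Basis. inner x u = 0) \<longleftrightarrow> x = 0"
    by (simp add: Basis_quat_def inner_quat_def quat_eq_iff[of x] zero_quat_def)
qed

end

lemma inner_quat_mult_left: "inner x (a * y) = inner (qcnj a * x) y" for x y a :: quat
  by (simp add: inner_quat_def times_quat_def qcnj_def algebra_simps)

lemma inner_quat_eq_Re: "inner x y = qRe (qcnj x * y)"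
  by (simp add: inner_quat_def times_quat_def qcnj_def)

lemma qRe_sum: "qRe (sum f S) = (\<Sum>i\<in>S. qRe (f i))"
  by (induction S rule: infinite_finite_induct) (simp_all add: zero_quat_def plus_quat_def)

lemma qRe_of_real [simp]: "qRe (of_real t) = t"
  by (simp add: of_real_def scaleR_quat_def one_quat_def)

lemma qcnj_qcnj [simp]: "qcnj (qcnj x) = x"
  by (simp add: qcnj_def)

lemma qcnj_mult: "qcnj (x * y) = qcnj y * qcnj x"
  by (simp add: qcnj_def times_quat_def)

lemma qcnj_sum: "qcnj (sum f S) = (\<Sum>i\<in>S. qcnj (f i))"
  by (induction S rule: infinite_finite_induct)
    (simp_all add: quat_eq_iff qcnj_def zero_quat_def plus_quat_def)

section \<open>Quaternion matrices\<close>

lemma adjoint_mat_adjoint_mat [simp]: "adjoint_mat (adjoint_mat A) = A"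
  by (simp add: adjoint_mat_def vec_eq_iff)

lemma adjoint_mat_mult: "adjoint_mat (A ** B) = adjoint_mat B ** adjoint_mat A"
  by (simp add: adjoint_mat_def matrix_matrix_mult_def vec_eq_iff qcnj_sum qcnj_mult)

lemma inner_adjoint_mat: "inner x (A *v y) = inner (adjoint_mat A *v x) y"
  for A :: "quat ^ 'n ^ 'm"
proof -
  have "inner x (A *v y) = (\<Sum>i\<in>UNIV. \<Sum>j\<in>UNIV. inner (qcnj (A $ i $ j) * x $ i) (y $ j))"
    by (simp add: inner_vec_def matrix_vector_mult_def inner_sum_right inner_quat_mult_left)
  also have "\<dots> = inner (adjoint_mat A *v x) y"
    by (subst sum.swap)
      (simp add: inner_vec_def matrix_vector_mult_def inner_sum_left adjoint_mat_def)
  finally show ?thesis .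
qed

lemma scaleR_matrix_vector_mult: "(k *\<^sub>R A) *v x = k *\<^sub>R (A *v x)" for A :: "quat ^ 'n ^ 'm"
  by (simp add: matrix_vector_mult_def vec_eq_iff scaleR_sum_right)

lemma matrix_vector_mult_scaleR_right: "A *v (k *\<^sub>R x) = k *\<^sub>R (A *v x)" for A :: "quat ^ 'n ^ 'm"
  by (rule linear_cmul[OF matrix_vector_mul_linear])

text \<open>The kernel of K^* is the orthogonal complement of the range of K, so an inclusion of
  kernels turns into an inclusion of ranges.\<close>

lemma adjoint_kernel_imp_range_subset:
  fixes K :: "quat ^ 'p ^ 'n" and L :: "quat ^ 'm ^ 'n"
  assumes "\<And>q. adjoint_mat K *v q = 0 \<Longrightarrow> adjoint_mat L *v q = 0"
  shows "\<exists>W. K ** W = L"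
proof -
  have "\<exists>y. K *v y = L *v v" for v
  proof -
    have sub: "subspace (range ((*v) K))"
      by (simp add: linear_subspace_image)
    obtain p q where p: "p \<in> span (range ((*v) K))"
      and q: "\<And>w. w \<in> span (range ((*v) K)) \<Longrightarrow> orthogonal q w" and pq: "L *v v = p + q"
      by (rule orthogonal_subspace_decomp_exists[of "range ((*v) K)" "L *v v"]) blast
    have "inner (adjoint_mat K *v q) z = 0" for z
      using q[of "K *v z"] by (simp add: span_base orthogonal_def inner_adjoint_mat)
    then have "adjoint_mat K *v q = 0"
      by (metis inner_eq_zero_iff)
    \<comment> \<open>The residual q is orthogonal both to L v = p + q and to p, hence to
      itself.\<close>
    then have "inner q (L *v v) = 0"
      by (simp add: assms inner_adjoint_mat)
    moreover have "inner q p = 0"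
      using q[OF p] by (simp add: orthogonal_def)
    ultimately have "q = 0"
      by (simp add: pq inner_add_right)
    then show ?thesis
      using p pq by (metis add.right_neutral imageE span_eq_iff sub)
  qed
  then obtain y where y: "\<And>v. K *v y v = L *v v"
    by metis
  \<comment> \<open>The chosen solutions \<open>y v\<close> need not depend linearly on v; only
    those at the unit vectors serve, as columns of W.\<close>
  have "K ** (\<chi> i j. y (axis j 1) $ i) = L"
  proof -
    have "(K ** (\<chi> i j. y (axis j 1) $ i)) $ i $ j = (K *v y (axis j 1)) $ i" for i j
      by (simp add: matrix_matrix_mult_def matrix_vector_mult_def)
    moreover have "(L *v axis j 1) $ i = L $ i $ j" for i j
      by (simp add: matrix_vector_mult_def axis_def if_distrib cong: if_cong)
    ultimately show ?thesis
      by (simp add: vec_eq_iff y)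
  qed
  then show ?thesis ..
qed

text \<open>All values of S - T lie in the kernel of B, hence in that of C. This replaces
  cancellation of factors that are not invertible.\<close>

lemma matrix_mult_left_cancel_kernel:
  fixes B :: "quat ^ 'n ^ 'm"
  assumes "\<And>x. B *v x = 0 \<Longrightarrow> C *v x = 0" and "B ** S = B ** T"
  shows "C ** S = C ** T"
proof -
  have "C *v (S *v x - T *v x) = 0" for x
    using assms(2)
    by (intro assms(1)) (simp add: matrix_vector_mult_diff_distrib matrix_vector_mul_assoc)
  then show ?thesis
    by (simp add: matrix_eq matrix_vector_mult_diff_distrib matrix_vector_mul_assoc)
qed

section \<open>Positive definite matrices\<close>

lemma pos_def_adjoint: "pos_def P \<Longrightarrow> adjoint_mat P = P"
  by (simp add: pos_def_def)

lemma pos_def_inner_pos: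
  assumes "pos_def P" "x \<noteq> 0"
  shows "inner x (P *v x) > 0"
proof -
  obtain t where "t > 0" "(\<Sum>i\<in>UNIV. qcnj (x $ i) * (P *v x) $ i) = of_real t"
    using assms by (auto simp: pos_def_def)
  then show ?thesis
    by (simp add: inner_vec_def inner_quat_eq_Re flip: qRe_sum)
qed

lemma pos_def_inner_nonneg: "pos_def P \<Longrightarrow> inner x (P *v x) \<ge> 0"
  by (cases "x = 0") (simp_all add: pos_def_inner_pos less_imp_le)

lemma pos_def_inner_eq_0: "pos_def P \<Longrightarrow> inner x (P *v x) = 0 \<Longrightarrow> x = 0"
  by (metis pos_def_inner_pos less_irrefl)

lemma pos_def_inner_commute:
  assumes "pos_def P"
  shows "inner x (P *v y) = inner y (P *v x)"
  by (metis assms inner_adjoint_mat inner_commute pos_def_adjoint)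

text \<open>P and its adjoint have the same real quadratic form, so both are injective: the adjoint
  yields a right inverse W, and P turns P (W P) = P into W P = I.\<close>

lemma invertible_if_inner_pos:
  fixes P :: "quat ^ 'n ^ 'n"
  assumes "\<And>x. x \<noteq> 0 \<Longrightarrow> inner x (P *v x) > 0"
  shows "invertible P"
proof -
  have ker: "x = 0" if "P *v x = 0 \<or> adjoint_mat P *v x = 0" for x
  proof (rule ccontr)
    assume "x \<noteq> 0"
    then have "inner x (P *v x) > 0"
      by (rule assms)
    moreover have "inner x (P *v x) = inner (adjoint_mat P *v x) x"
      by (rule inner_adjoint_mat)
    ultimately show False
      using that by auto
  qed
  have "adjoint_mat (mat 1) *v q = 0" if "adjoint_mat P *v q = 0" for q
    using ker[of q] that by (metis matrix_vector_mult_0_right)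
  then obtain W where W: "P ** W = mat 1"
    using adjoint_kernel_imp_range_subset[of P "mat 1"] by metis
  have "mat 1 ** (W ** P) = mat 1 ** mat 1"
  proof (rule matrix_mult_left_cancel_kernel)
    show "P ** (W ** P) = P ** mat 1"
      by (simp add: matrix_mul_assoc W)
    show "mat 1 *v x = 0" if "P *v x = 0" for x
      using ker[of x] that by simp
  qed
  with W show ?thesis
    by (auto simp: invertible_def)
qed

lemma pos_def_invertible: "pos_def P \<Longrightarrow> invertible P"
  by (rule invertible_if_inner_pos) (rule pos_def_inner_pos)

lemma matrix_inv_mult:
  assumes "invertible P"
  shows "P ** matrix_inv P = mat 1" "matrix_inv P ** P = mat 1"
proof -
  have "P ** matrix_inv P = mat 1 \<and> matrix_inv P ** P = mat 1"
    using assms unfolding invertible_def matrix_inv_def by (rule someI_ex)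
  then show "P ** matrix_inv P = mat 1" "matrix_inv P ** P = mat 1"
    by simp_all
qed

text \<open>The constant is the minimum of the form on the compact unit sphere; homogeneity of
  degree two extends the bound to all x.\<close>

lemma pos_def_coercive:
  fixes P :: "quat ^ 'n ^ 'n"
  assumes "pos_def P"
  obtains c where "c > 0" "\<And>x. c * (norm x)\<^sup>2 \<le> inner x (P *v x)"
proof -
  let ?S = "sphere 0 1 :: (quat ^ 'n) set"
  have "continuous_on ?S (\<lambda>x. inner x (P *v x))"
    by (rule continuous_on_inner[OF continuous_on_id linear_continuous_on
          [OF linear_conv_bounded_linear[THEN iffD1, OF matrix_vector_mul_linear]]])
  moreover have "?S \<noteq> {}"
    by (simp add: sphere_eq_empty)
  ultimately obtain u where u: "u \<in> ?S" "\<And>x. x \<in> ?S \<Longrightarrow> inner u (P *v u) \<le> inner x (P *v x)"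
    using continuous_attains_inf[OF compact_sphere] by blast
  show ?thesis
  proof (rule that)
    show "inner u (P *v u) > 0"
      using u(1) by (intro pos_def_inner_pos assms) auto
    show "inner u (P *v u) * (norm x)\<^sup>2 \<le> inner x (P *v x)" for x
    proof (cases "x = 0")
      case False
      have "inner u (P *v u) \<le> inner (inverse (norm x) *\<^sub>R x) (P *v (inverse (norm x) *\<^sub>R x))"
        using False by (intro u(2)) simp
      also have "\<dots> = inner x (P *v x) / (norm x)\<^sup>2"
        by (simp add: matrix_vector_mult_scaleR_right power2_eq_square divide_simps)
      finally show ?thesis
        using False by (simp add: divide_simps)
    qed simp
  qed
qed

section \<open>The weighted Moore--Penrose inverse\<close>

lemma mult_weighted_adjoint:
  assumes "invertible N"
  shows "N ** weighted_adjoint M N A = adjoint_mat A ** M"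
  by (simp add: weighted_adjoint_def matrix_mul_assoc matrix_inv_mult[OF assms])

text \<open>Multiplying by N removes the inverse inside G. Paired with a vector, this says that G is
  the adjoint of A for the inner products weighted by M and N.\<close>

lemma mult_weighted_adjoint_vector:
  fixes N :: "quat ^ 'n ^ 'n"
  assumes "pos_def N"
  shows "N *v (weighted_adjoint M N A *v x) = adjoint_mat A *v (M *v x)"
  by (simp add: matrix_vector_mul_assoc mult_weighted_adjoint[OF pos_def_invertible[OF assms]])

lemma inner_adjoint_mat_left: "inner x (adjoint_mat A *v y) = inner (A *v x) y"
  by (simp add: inner_adjoint_mat[of x])

text \<open>Pairing G A x with x in the N-weighted product gives the squared M-norm of A x.\<close>

lemma weighted_Gram_kernel:
  fixes A :: "quat ^ 'n ^ 'm"
  assumes M: "pos_def M" and N: "pos_def N" and "weighted_adjoint M N A ** A *v x = 0"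
  shows "A *v x = 0"
proof (rule pos_def_inner_eq_0[OF M])
  have "inner (A *v x) (M *v (A *v x)) = inner x (N *v (weighted_adjoint M N A ** A *v x))"
    by (simp only: mult_weighted_adjoint_vector[OF N] inner_adjoint_mat_left
        flip: matrix_vector_mul_assoc)
  then show "inner (A *v x) (M *v (A *v x)) = 0"
    using assms(3) by simp
qed

lemma weighted_adjoint_kernel:
  fixes A :: "quat ^ 'n ^ 'm"
  assumes N: "pos_def N" and "A ** weighted_adjoint M N A *v x = 0"
  shows "weighted_adjoint M N A *v x = 0"
proof (rule pos_def_inner_eq_0[OF N])
  let ?G = "weighted_adjoint M N A"
  have "inner (?G *v x) (N *v (?G *v x)) = inner (A ** ?G *v x) (M *v x)"
    by (simp only: mult_weighted_adjoint_vector[OF N] inner_adjoint_mat_left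
        flip: matrix_vector_mul_assoc)
  then show "inner (?G *v x) (N *v (?G *v x)) = 0"
    using assms(2) by simp
qed

section \<open>Existence and uniqueness of the weighted inverse\<close>

lemma adjoint_matrix_inv_pos_def:
  assumes "pos_def P"
  shows "adjoint_mat (matrix_inv P) = matrix_inv P"
proof -
  note inv = matrix_inv_mult[OF pos_def_invertible[OF assms]]
  have one: "adjoint_mat (mat 1) = mat 1"
    by (metis adjoint_mat_adjoint_mat adjoint_mat_mult matrix_mul_lid matrix_mul_rid)
  have "adjoint_mat (matrix_inv P) ** P = adjoint_mat (P ** matrix_inv P)"
    by (simp only: adjoint_mat_mult pos_def_adjoint[OF assms])
  also have "\<dots> = mat 1"
    by (simp only: inv one)
  finally show ?thesis
    by (metis inv(1) matrix_mul_assoc matrix_mul_lid matrix_mul_rid)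
qed

lemma weighted_adjoint_factorization:
  fixes A :: "quat ^ 'n ^ 'm"
  assumes M: "pos_def M" and N: "pos_def N"
  obtains W where "weighted_adjoint M N A ** A ** weighted_adjoint M N A ** W
    = weighted_adjoint M N A"
proof -
  let ?G = "weighted_adjoint M N A"
  have "adjoint_mat ?G *v q = 0" if q: "adjoint_mat (?G ** A ** ?G) *v q = 0" for q
  proof -
    \<comment> \<open>Since G^* = M A N^-1, this vector satisfies G^* q = M w and (G A G)^* q = M A
      G w. Stripping M, A and G in turn forces w = 0.\<close>
    define w where "w = A *v (matrix_inv N *v q)"
    have adj: "adjoint_mat ?G = M ** A ** matrix_inv N"
      by (simp add: weighted_adjoint_def adjoint_mat_mult pos_def_adjoint[OF M]
          adjoint_matrix_inv_pos_def[OF N] matrix_mul_assoc)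
    have "M *v (A ** ?G *v w) = adjoint_mat (?G ** A ** ?G) *v q"
      by (simp add: w_def adjoint_mat_mult adj matrix_vector_mul_assoc matrix_mul_assoc)
        (simp add: weighted_adjoint_def matrix_mul_assoc)
    then have "A ** ?G *v w = 0"
      using q pos_def_inner_eq_0[OF M, of "A ** ?G *v w"] by simp
    then have "?G *v w = 0"
      by (rule weighted_adjoint_kernel[OF N])
    then have "w = 0"
      unfolding w_def
      by (intro weighted_Gram_kernel[OF M N]) (simp add: matrix_vector_mul_assoc matrix_mul_assoc)
    then show ?thesis
      by (simp add: adj w_def flip: matrix_vector_mul_assoc)
  qed
  then show ?thesis
    using adjoint_kernel_imp_range_subset that by blast
qed

lemma is_weighted_MP_inverseI:
  fixes A :: "quat ^ 'n ^ 'm"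
  assumes M: "pos_def M" and N: "pos_def N"
    and W: "weighted_adjoint M N A ** A ** weighted_adjoint M N A ** W = weighted_adjoint M N A"
  shows "is_weighted_MP_inverse M N A (weighted_adjoint M N A ** W)"
proof -
  let ?G = "weighted_adjoint M N A"
  define X where "X = ?G ** W"
  note NG = mult_weighted_adjoint[OF pos_def_invertible[OF N], of M A]
  have GAX: "?G ** A ** X = ?G"
    using W by (simp add: X_def matrix_mul_assoc)
  \<comment> \<open>G cancels on the left of G A X A = G A because G A and A have the same
    kernel.\<close>
  have "A ** (X ** A) = A ** mat 1"
    by (rule matrix_mult_left_cancel_kernel[of "?G ** A"])
      (use weighted_Gram_kernel[OF M N] in \<open>auto simp: matrix_mul_assoc GAX\<close>)
  then have AXA: "A ** X ** A = A"
    by (simp add: matrix_mul_assoc)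
  have "?G ** (W ** A ** X) = ?G ** W"
  proof (rule matrix_mult_left_cancel_kernel[of "A ** ?G"])
    show "A ** ?G ** (W ** A ** X) = A ** ?G ** W"
      using AXA by (metis X_def matrix_mul_assoc)
  qed (rule weighted_adjoint_kernel[OF N])
  then have XAX: "X ** A ** X = X"
    by (simp add: X_def matrix_mul_assoc)
  \<comment> \<open>The aim is M A X = (A X)^* M (A X), whose right side is visibly
    Hermitian.\<close>
  have "adjoint_mat A ** M ** A ** X = adjoint_mat A ** M"
    by (metis GAX NG matrix_mul_assoc)
  then have "adjoint_mat X ** adjoint_mat A ** M ** A ** X = adjoint_mat (M ** A ** X)"
    by (metis adjoint_mat_mult matrix_mul_assoc pos_def_adjoint[OF M])
  moreover have "adjoint_mat (adjoint_mat X ** adjoint_mat A ** M ** A ** X)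
      = adjoint_mat X ** adjoint_mat A ** M ** A ** X"
    by (simp add: adjoint_mat_mult pos_def_adjoint[OF M] matrix_mul_assoc)
  ultimately have MAX: "adjoint_mat (M ** A ** X) = M ** A ** X"
    by (metis adjoint_mat_adjoint_mat)
  have NX: "N ** X = adjoint_mat A ** M ** W"
    by (simp add: X_def NG matrix_mul_assoc)
  \<comment> \<open>Writing N X as A^* M W exposes a factor A^*, and A^* X^* A^* = A^* is the
    adjoint of A X A = A.\<close>
  have "adjoint_mat (X ** A) ** N ** (X ** A) = adjoint_mat (A ** X ** A) ** M ** W ** A"
    by (simp add: adjoint_mat_mult matrix_mul_assoc) (metis NX matrix_mul_assoc)
  also have "\<dots> = N ** X ** A"
    by (simp add: AXA NX)
  finally have PNP: "adjoint_mat (X ** A) ** N ** (X ** A) = N ** X ** A" .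
  have "adjoint_mat (adjoint_mat (X ** A) ** N ** (X ** A)) = adjoint_mat (X ** A) ** N ** (X ** A)"
    by (simp add: adjoint_mat_mult pos_def_adjoint[OF N] matrix_mul_assoc)
  then have "adjoint_mat (N ** X ** A) = N ** X ** A"
    by (simp only: PNP)
  with AXA XAX MAX show ?thesis
    by (simp add: is_weighted_MP_inverse_def X_def)
qed

text \<open>The adjoint of P E F = P G moves P through both factors in reverse order, giving P F E =
  P G; then P cancels.\<close>

lemma self_adjoint_product_commute:
  fixes E F G P :: "quat ^ 'n ^ 'n"
  assumes P: "pos_def P" and EF: "E ** F = G"
    and E: "adjoint_mat (P ** E) = P ** E" and F: "adjoint_mat (P ** F) = P ** F"
    and G: "adjoint_mat (P ** G) = P ** G"
  shows "F ** E = G"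
proof -
  have "P ** G = adjoint_mat F ** (adjoint_mat E ** P)"
    using G by (simp add: adjoint_mat_mult pos_def_adjoint[OF P] matrix_mul_assoc flip: EF)
  also have "\<dots> = P ** (F ** E)"
    using E F by (simp add: adjoint_mat_mult pos_def_adjoint[OF P] matrix_mul_assoc)
  finally show ?thesis
    by (metis matrix_inv_mult(2)[OF pos_def_invertible[OF P]] matrix_mul_assoc matrix_mul_lid)
qed

lemma is_weighted_MP_inverse_unique:
  fixes A :: "quat ^ 'n ^ 'm"
  assumes M: "pos_def M" and N: "pos_def N"
    and X: "is_weighted_MP_inverse M N A X" and Y: "is_weighted_MP_inverse M N A Y"
  shows "X = Y"
proof -
  note eqs = X[unfolded is_weighted_MP_inverse_def] Y[unfolded is_weighted_MP_inverse_def]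
  \<comment> \<open>The product in the other order collapses to A Y by A X A = A, this one to A X by
    A Y A = A, so A X = A Y. With X A = Y A, it follows that X = X A X = X A Y = Y A Y = Y.\<close>
  have "A ** Y ** (A ** X) = A ** Y"
    by (rule self_adjoint_product_commute[OF M]) (use eqs in \<open>simp_all add: matrix_mul_assoc\<close>)
  then have AX: "A ** X = A ** Y"
    using eqs by (simp add: matrix_mul_assoc)
  have XYA: "X ** A ** (Y ** A) = X ** A"
    using eqs by (metis matrix_mul_assoc)
  have "Y ** A ** (X ** A) = X ** A"
    by (rule self_adjoint_product_commute[OF N XYA]) (use eqs in \<open>simp_all add: matrix_mul_assoc\<close>)
  then have XA: "X ** A = Y ** A"
    using eqs by (metis matrix_mul_assoc)
  show ?thesis
    using eqs AX XA by (metis matrix_mul_assoc)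
qed

lemma weighted_MP_inverse_eq:
  assumes "pos_def M" "pos_def N" "is_weighted_MP_inverse M N A X"
  shows "weighted_MP_inverse M N A = X"
  unfolding weighted_MP_inverse_def
  using assms is_weighted_MP_inverse_unique[OF assms(1,2)] by blast

section \<open>The regularized problem\<close>

lemma mult_regularized:
  fixes A :: "quat ^ 'n ^ 'm"
  assumes "pos_def N"
  shows "N *v ((l *\<^sub>R mat 1 + weighted_adjoint M N A ** A) *v x)
    = l *\<^sub>R (N *v x) + adjoint_mat A *v (M *v (A *v x))"
  by (simp add: matrix_vector_mult_add_rdistrib matrix_vector_right_distrib
      scaleR_matrix_vector_mult matrix_vector_mult_scaleR_right
      mult_weighted_adjoint_vector[OF assms] flip: matrix_vector_mul_assoc)

lemma inner_mult_regularized: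
  fixes A :: "quat ^ 'n ^ 'm"
  assumes "pos_def N"
  shows "inner x (N *v ((l *\<^sub>R mat 1 + weighted_adjoint M N A ** A) *v x))
    = l * inner x (N *v x) + inner (A *v x) (M *v (A *v x))"
  by (simp add: mult_regularized[OF assms] inner_add_right inner_adjoint_mat_left)

text \<open>The matrix itself need not be Hermitian. Multiplied by N it becomes \<open>l\<close> N +
  A^* M A, whose form is positive.\<close>

lemma invertible_regularized:
  fixes A :: "quat ^ 'n ^ 'm"
  assumes M: "pos_def M" and N: "pos_def N" and "l > 0"
  shows "invertible (l *\<^sub>R mat 1 + weighted_adjoint M N A ** A)" (is "invertible ?B")
proof -
  have "invertible (N ** ?B)"
  proof (rule invertible_if_inner_pos)
    fix x :: "quat ^ 'n"
    assume "x \<noteq> 0"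
    then show "inner x (N ** ?B *v x) > 0"
      using \<open>l > 0\<close> pos_def_inner_pos[OF N] pos_def_inner_nonneg[OF M, of "A *v x"]
      by (simp add: inner_mult_regularized[OF N] add_pos_nonneg flip: matrix_vector_mul_assoc)
  qed
  moreover have "invertible (matrix_inv N)"
    using matrix_inv_mult[OF pos_def_invertible[OF N]] by (auto simp: invertible_def)
  ultimately have "invertible (matrix_inv N ** (N ** ?B))"
    by (rule invertible_mult[rotated])
  then show ?thesis
    by (simp add: matrix_mul_assoc matrix_inv_mult[OF pos_def_invertible[OF N]])
qed

lemma regularized_energy_bound:
  fixes A :: "quat ^ 'n ^ 'm"
  assumes M: "pos_def M" and N: "pos_def N" and "l > 0"
    and e: "(l *\<^sub>R mat 1 + weighted_adjoint M N A ** A) *v e = l *\<^sub>R (weighted_adjoint M N A *v w)"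
  shows "inner e (N *v e) \<le> l / 4 * inner w (M *v w)"
proof -
  let ?a = "A *v e"
  have "l * inner e (N *v e) + inner ?a (M *v ?a)
      = inner e (N *v (l *\<^sub>R (weighted_adjoint M N A *v w)))"
    by (simp flip: inner_mult_regularized[OF N] e)
  also have "\<dots> = l * inner ?a (M *v w)"
    by (simp add: matrix_vector_mult_scaleR_right mult_weighted_adjoint_vector[OF N]
        inner_adjoint_mat_left)
  finally have energy: "l * inner e (N *v e) + inner ?a (M *v ?a) = l * inner ?a (M *v w)" .
  \<comment> \<open>The shift \<open>l / 2\<close> makes the cross term match \<open>energy\<close>,
    so every term in A e drops out. The remainder, quadratic in \<open>l\<close>, keeps one factor
    \<open>l\<close> after division.\<close>
  have "0 \<le> inner (?a - (l / 2) *\<^sub>R w) (M *v (?a - (l / 2) *\<^sub>R w))"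
    by (rule pos_def_inner_nonneg[OF M])
  also have "\<dots> = inner ?a (M *v ?a) - l * inner ?a (M *v w) + l\<^sup>2 / 4 * inner w (M *v w)"
    by (simp add: matrix_vector_mult_diff_distrib matrix_vector_mult_scaleR_right inner_diff_left
        inner_diff_right pos_def_inner_commute[OF M, of w ?a] power2_eq_square algebra_simps)
  finally have "l * inner e (N *v e) \<le> l * (l / 4 * inner w (M *v w))"
    using energy by (simp add: power2_eq_square)
  then show ?thesis
    using \<open>l > 0\<close> by simp
qed

text \<open>Testing on unit vectors recovers every entry, so the error may be estimated for one
  fixed vector at a time.\<close>

lemma tendsto_matrixI:
  fixes F :: "'a \<Rightarrow> quat ^ 'n ^ 'm"
  assumes "\<And>v. ((\<lambda>l. F l *v v) \<longlongrightarrow> L *v v) net"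
  shows "(F \<longlongrightarrow> L) net"
proof (intro vec_tendstoI)
  fix i j
  have col: "(B *v axis j 1) $ i = B $ i $ j" for B :: "quat ^ 'n ^ 'm"
    by (simp add: matrix_vector_mult_def axis_def if_distrib cong: if_cong)
  show "((\<lambda>l. F l $ i $ j) \<longlongrightarrow> L $ i $ j) net"
    using tendsto_vec_nth[OF assms[of "axis j 1"], of i] by (simp add: col)
qed

theorem lemma3p1:
  fixes A :: "quat ^ 'n ^ 'm" and M :: "quat ^ 'm ^ 'm" and N :: "quat ^ 'n ^ 'n" and r :: nat
  assumes "quat_rank A = r"
    and "pos_def M" and "pos_def N"
  shows "(\<forall>l::real. l > 0 \<longrightarrow> invertible (l *\<^sub>R mat 1 + weighted_adjoint M N A ** A)) \<and>
    ((\<lambda>l::real. matrix_inv (l *\<^sub>R mat 1 + weighted_adjoint M N A ** A) ** weighted_adjoint M N A)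
      \<longlongrightarrow> weighted_MP_inverse M N A) (at_right 0)"
proof (intro conjI allI impI)
  note M = assms(2) and N = assms(3)
  let ?G = "weighted_adjoint M N A"
  let ?B = "\<lambda>l::real. l *\<^sub>R mat 1 + ?G ** A"
  let ?T = "\<lambda>l::real. matrix_inv (?B l) ** ?G"
  show "invertible (?B l)" if "l > 0" for l
    using M N that by (rule invertible_regularized)
  obtain W where W: "?G ** A ** ?G ** W = ?G"
    using weighted_adjoint_factorization[OF M N] by blast
  define X where "X = ?G ** W"
  have X: "weighted_MP_inverse M N A = X"
    unfolding X_def by (intro weighted_MP_inverse_eq is_weighted_MP_inverseI M N W)
  obtain c where c: "c > 0" "\<And>x. c * (norm x)\<^sup>2 \<le> inner x (N *v x)"
    using pos_def_coercive[OF N] by blast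
  have "(?T \<longlongrightarrow> X) (at_right 0)"
  proof (rule tendsto_matrixI)
    fix v
    \<comment> \<open>W is independent of \<open>l\<close>, so K is constant along the
      limit.\<close>
    define K where "K = inner (W *v v) (M *v (W *v v))"
    have bound: "norm (?T l *v v - X *v v) \<le> sqrt (l / 4 * K / c)" if "l > 0" for l
    proof -
      define e where "e = X *v v - ?T l *v v"
      have "?B l ** ?T l = ?G"
        using matrix_inv_mult(1)[OF invertible_regularized[OF M N that]]
        by (metis matrix_mul_assoc matrix_mul_lid)
      then have "?B l *v (?T l *v v) = ?G *v v"
        by (simp add: matrix_vector_mul_assoc)
      \<comment> \<open>Here G A X = G by the choice of W, so the terms G v cancel in the equation
        for e.\<close>
      moreover have "?B l *v (X *v v) = l *\<^sub>R (X *v v) + ?G *v v"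
        by (simp add: matrix_vector_mult_add_rdistrib scaleR_matrix_vector_mult)
          (simp add: matrix_vector_mul_assoc matrix_mul_assoc X_def W)
      ultimately have "?B l *v e = l *\<^sub>R (?G *v (W *v v))"
        by (simp add: e_def X_def matrix_vector_mult_diff_distrib matrix_vector_mul_assoc)
      then have "inner e (N *v e) \<le> l / 4 * K"
        unfolding K_def by (rule regularized_energy_bound[OF M N that])
      then have "c * (norm e)\<^sup>2 \<le> l / 4 * K"
        using c(2)[of e] by linarith
      then have "(norm e)\<^sup>2 \<le> l / 4 * K / c"
        using c(1) by (simp add: pos_le_divide_eq mult.commute)
      then show ?thesis
        by (simp add: e_def norm_minus_commute real_le_rsqrt)
    qed
    have "((\<lambda>l. sqrt (l / 4 * K / c)) \<longlongrightarrow> sqrt (0 / 4 * K / c)) (at_right 0)"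
      using c(1) by (intro tendsto_intros) auto
    then have "((\<lambda>l. sqrt (l / 4 * K / c)) \<longlongrightarrow> 0) (at_right 0)"
      by simp
    then have "((\<lambda>l. ?T l *v v - X *v v) \<longlongrightarrow> 0) (at_right 0)"
      by (rule Lim_null_comparison[rotated])
        (use bound in \<open>auto intro: eventually_at_right_less[THEN eventually_mono]\<close>)
    then show "((\<lambda>l. ?T l *v v) \<longlongrightarrow> X *v v) (at_right 0)"
      by (rule Lim_null[THEN iffD2])
  qed
  then show "(?T \<longlongrightarrow> weighted_MP_inverse M N A) (at_right 0)"
    by (simp only: X)
qed

end
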